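(* For every integer $n\ge0$, let $\mathscr{A}_n=\{f\in\mathscr{A}:\ \#\mathrm{Crit}'(f)\le n\}$. Then $$\sup_{f\in\mathscr{A}_n}\#\Sigma_{\max}(f)\le 3n+4 .$$
   Context: Let $I\subset\mathbb{R}$ be a compact interval. For a differentiable map $f:I\to I$, $\mathrm{Crit}(f)$ is the set of points where $Df$ vanishes; the Julia set $J(f)$ is the set of $x\in I$ such that for every neighborhood $V$ of $x$ the family $\{f^n|_V\}_{n\ge0}$ is not equicontinuous; $\mathrm{Crit}'(f)=\mathrm{Crit}(f)\cap J(f)$; $\mathrm{Per}(f)$ is the set of periodic points; $\#$ denotes cardinality. $\mathscr{A}$ is the collection of all non-injective differentiable maps $f:I\to I$ such that: $\mathrm{Crit}(f)$ is finite; $Df$ is Hölder continuous; each critical point $c$ is non-flat, i.e. there are a number $\ell_c\ge1$ and diffeomorphisms $\varphi,\psi$ with $D\varphi,D\psi$ Hölder continuous, $\varphi(c)=\psi(f(c))=0$, and $|\psi\circ f|=\pm|\varphi|^{\ell_c}$ on a neighborhood of $c$ in $I$; $J(f)$ is completely invariant ($f(J(f))=f^{-1}(J(f))=J(f)$) and contains at least two points; every $p\in\mathrm{Per}(f)$, of period $N$, is hyperbolic repelling, $|D(f^N)(p)|>1$; $f$ is topologically exact on $J(f)$, i.e. for each non-empty (relatively) open $U\subset J(f)$ there is $n\ge0$ with $J(f)\subset f^n(U)$. The action of $f$ is always restricted to $J(f)$. A $\mathrm{Crit}'(f)$-exceptional set is a non-empty finite forward invariant set $\Sigma\subset J(f)$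 with $\emptyset\ne f^{-1}(\Sigma)\setminus\Sigma\subset\mathrm{Crit}'(f)$. $\Sigma_{\max}(f)$ is the union of all $\mathrm{Crit}'(f)$-exceptional sets. *)

theory Defs
  imports "HOL-Analysis.Analysis" "HOL-Library.Extended_Nat"
begin

(* A map f : I -> I is a function of type real => real with f ` I \<subseteq> I. Its values outside I
   play no role: derivatives, preimages, injectivity and neighbourhoods are all taken within I. *)

definition ecard :: "'a set \<Rightarrow> enat" where
  "ecard A = (if finite A then enat (card A) else \<infinity>)"

abbreviation deriv_in :: "real set \<Rightarrow> (real \<Rightarrow> real) \<Rightarrow> real \<Rightarrow> real" where
  "deriv_in I f x \<equiv> vector_derivative f (at x within I)"

definition holder_on :: "real set \<Rightarrow> (real \<Rightarrow> real) \<Rightarrow> bool" where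
  "holder_on S g \<longleftrightarrow> (\<exists>\<alpha> C. 0 < \<alpha> \<and> \<alpha> \<le> 1 \<and> 0 \<le> C \<and>
     (\<forall>x\<in>S. \<forall>y\<in>S. \<bar>g x - g y\<bar> \<le> C * \<bar>x - y\<bar> powr \<alpha>))"

definition equicontinuous_on :: "real set \<Rightarrow> (nat \<Rightarrow> real \<Rightarrow> real) \<Rightarrow> bool" where
  "equicontinuous_on V F \<longleftrightarrow> (\<forall>x\<in>V. \<forall>\<epsilon>>0. \<exists>\<delta>>0. \<forall>n. \<forall>y\<in>V.
     dist y x < \<delta> \<longrightarrow> dist (F n y) (F n x) < \<epsilon>)"

definition Crit :: "real set \<Rightarrow> (real \<Rightarrow> real) \<Rightarrow> real set" where
  "Crit I f = {x \<in> I. deriv_in I f x = 0}"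

definition Julia :: "real set \<Rightarrow> (real \<Rightarrow> real) \<Rightarrow> real set" where
  "Julia I f = {x \<in> I. \<forall>V. openin (top_of_set I) V \<and> x \<in> V \<longrightarrow>
     \<not> equicontinuous_on V (\<lambda>n. f ^^ n)}"

definition Crit_Julia :: "real set \<Rightarrow> (real \<Rightarrow> real) \<Rightarrow> real set" where
  "Crit_Julia I f = Crit I f \<inter> Julia I f"

definition Per :: "real set \<Rightarrow> (real \<Rightarrow> real) \<Rightarrow> real set" where
  "Per I f = {p \<in> I. \<exists>N\<ge>1. (f ^^ N) p = p}"

definition period :: "(real \<Rightarrow> real) \<Rightarrow> real \<Rightarrow> nat" where
  "period f p = (LEAST N. N \<ge> 1 \<and> (f ^^ N) p = p)"

(* Diffeomorphisms of the real line with globally Hoelder continuous derivative. *)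
definition holder_diffeo :: "(real \<Rightarrow> real) \<Rightarrow> bool" where
  "holder_diffeo \<phi> \<longleftrightarrow> bij \<phi> \<and> \<phi> differentiable_on UNIV \<and> inv \<phi> differentiable_on UNIV \<and>
     holder_on UNIV (deriv \<phi>)"

(* A sign in front of the right-hand side would be vacuous, since both sides of the equation
   are non-negative. *)
definition non_flat :: "real set \<Rightarrow> (real \<Rightarrow> real) \<Rightarrow> real \<Rightarrow> bool" where
  "non_flat I f c \<longleftrightarrow> (\<exists>(l::real) \<phi> \<psi>. l \<ge> 1 \<and> holder_diffeo \<phi> \<and> holder_diffeo \<psi> \<and>
     \<phi> c = 0 \<and> \<psi> (f c) = 0 \<and>
     (\<exists>V. openin (top_of_set I) V \<and> c \<in> V \<and> (\<forall>x\<in>V. \<bar>\<psi> (f x)\<bar> = \<bar>\<phi> x\<bar> powr l)))"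

definition topologically_exact_on :: "real set \<Rightarrow> (real \<Rightarrow> real) \<Rightarrow> bool" where
  "topologically_exact_on J f \<longleftrightarrow>
     (\<forall>U. openin (top_of_set J) U \<and> U \<noteq> {} \<longrightarrow> (\<exists>n. J \<subseteq> (f ^^ n) ` U))"

definition class_A :: "real set \<Rightarrow> (real \<Rightarrow> real) set" where
  "class_A I = {f. f ` I \<subseteq> I \<and> \<not> inj_on f I \<and> f differentiable_on I \<and>
     finite (Crit I f) \<and>
     holder_on I (deriv_in I f) \<and>
     (\<forall>c\<in>Crit I f. non_flat I f c) \<and>
     f ` Julia I f = Julia I f \<and> {x \<in> I. f x \<in> Julia I f} = Julia I f \<and>
     (\<exists>x\<in>Julia I f. \<exists>y\<in>Julia I f. x \<noteq> y) \<and>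
     (\<forall>p\<in>Per I f. \<bar>deriv_in I (f ^^ period f p) p\<bar> > 1) \<and>
     topologically_exact_on (Julia I f) f}"

definition class_A_n :: "real set \<Rightarrow> nat \<Rightarrow> (real \<Rightarrow> real) set" where
  "class_A_n I n = {f \<in> class_A I. card (Crit_Julia I f) \<le> n}"

(* f is regarded as a map of its Julia set, so the preimage of \<Sigma> is taken there. *)
definition exceptional :: "real set \<Rightarrow> (real \<Rightarrow> real) \<Rightarrow> real set \<Rightarrow> bool" where
  "exceptional I f \<Sigma> \<longleftrightarrow> \<Sigma> \<noteq> {} \<and> finite \<Sigma> \<and> \<Sigma> \<subseteq> Julia I f \<and> f ` \<Sigma> \<subseteq> \<Sigma> \<and>
     {x \<in> Julia I f. f x \<in> \<Sigma>} - \<Sigma> \<noteq> {} \<and>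
     {x \<in> Julia I f. f x \<in> \<Sigma>} - \<Sigma> \<subseteq> Crit_Julia I f"

definition Sigma_max :: "real set \<Rightarrow> (real \<Rightarrow> real) \<Rightarrow> real set" where
  "Sigma_max I f = \<Union>{\<Sigma>. exceptional I f \<Sigma>}"

end

theory Submission
  imports Defs
begin

text \<open>
  The argument is topological: \<open>f\<close> is continuous on an interval, its Julia set \<open>J\<close> is completely
  invariant, and \<open>f\<close> is topologically exact on \<open>J\<close>.

  Let \<open>\<Sigma> \<subseteq> J\<close> be finite and forward invariant, and suppose that \<open>A\<close>, the part of
  \<open>f\<^sup>-\<^sup>1(\<Sigma>)\<close> outside \<open>\<Sigma>\<close>, has at most \<open>n\<close> points. Every point of \<open>\<Sigma>\<close> has a preimage, and
  the preimages of all of them number \<open>#\<Sigma> + #A\<close>, so at most \<open>n\<close> points of \<open>\<Sigma>\<close> have several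
  preimages. Let \<open>x \<in> \<Sigma>\<close> have a single preimage \<open>y\<close>. Then \<open>f - x\<close> has constant sign on each side
  of \<open>y\<close>. If both signs agree, \<open>x\<close> is the maximum or the minimum of \<open>f\<close>, which happens for at most
  two points. Otherwise the graph of \<open>f\<close> crosses the level \<open>x\<close> exactly once, at \<open>y\<close>.

  The crossing cannot be upwards: one of the two sides of \<open>y\<close> would then be mapped into itself and
  contain points of \<open>J\<close>, whereas exactness spreads any open piece of \<open>J\<close> over all of \<open>J\<close>, which
  contains \<open>y\<close> (lemma \<open>no_upward_crossing\<close>). So it is downwards. Since two successive
  downward crossings give an upward crossing of \<open>f \<circ> f\<close>, the point \<open>y\<close> is not itself
  a crossing level. Hence \<open>x \<mapsto> y\<close> maps the crossing levels in \<open>\<Sigma>\<close> injectively into \<open>A\<close> together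
  with the at most \<open>n + 2\<close> other points of \<open>\<Sigma>\<close>, and
  \<open>#\<Sigma> \<le> (n + (n + 2)) + (n + 2) = 3 n + 4\<close> (lemma \<open>card_forward_invariant_le\<close>).

  Finite unions of exceptional sets are again of this kind, with \<open>A\<close> consisting of critical points
  of \<open>J\<close>, so the bound for each finite union passes to the union of all exceptional sets.
\<close>

text \<open>
  The single-crossing property is stated for an arbitrary map \<open>g\<close> because it is applied to
  \<open>f\<close> and to \<open>f \<circ> f\<close>.
\<close>

definition crosses_up :: "real set \<Rightarrow> (real \<Rightarrow> real) \<Rightarrow> real \<Rightarrow> real \<Rightarrow> bool" where
  "crosses_up I g y x \<longleftrightarrow> g y = x \<and> (\<forall>z\<in>I. (z < y \<longrightarrow> g z < x) \<and> (y < z \<longrightarrow> x < g z))"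

definition crosses_down :: "real set \<Rightarrow> (real \<Rightarrow> real) \<Rightarrow> real \<Rightarrow> real \<Rightarrow> bool" where
  "crosses_down I g y x \<longleftrightarrow> g y = x \<and> (\<forall>z\<in>I. (z < y \<longrightarrow> x < g z) \<and> (y < z \<longrightarrow> g z < x))"

lemma crosses_down_twice:
  assumes "f ` I \<subseteq> I" "crosses_down I f z y" "crosses_down I f y x"
  shows "crosses_up I (f ^^ 2) z x"
  using assms unfolding crosses_down_def crosses_up_def numeral_2_eq_2 by fastforce

lemma continuous_avoiding_constant_sign:
  fixes f :: "real \<Rightarrow> real"
  assumes "is_interval S" "continuous_on S f" "\<forall>z\<in>S. f z \<noteq> x"
  shows "(\<forall>z\<in>S. f z < x) \<or> (\<forall>z\<in>S. x < f z)"
proof -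
  have "is_interval (f ` S)"
    using assms by (simp add: is_interval_connected_1 connected_continuous_image)
  then show ?thesis
    using assms(3) unfolding is_interval_1 by (smt (verit) image_iff)
qed

lemma unique_preimage_extreme_or_crossing:
  fixes f :: "real \<Rightarrow> real"
  assumes I: "is_interval I" and cont: "continuous_on I f" and pre: "{z \<in> I. f z = x} = {y}"
  shows "(\<forall>z\<in>I. f z \<le> x) \<or> (\<forall>z\<in>I. x \<le> f z) \<or> crosses_up I f y x \<or> crosses_down I f y x"
proof -
  have "is_interval (I \<inter> {..<y})" "is_interval (I \<inter> {y<..})"
    using I by (auto intro!: is_interval_Int)
  moreover have "continuous_on (I \<inter> {..<y}) f" "continuous_on (I \<inter> {y<..}) f"
    using cont by (auto intro: continuous_on_subset)
  moreover have "\<forall>z\<in>I \<inter> {..<y}. f z \<noteq> x" "\<forall>z\<in>I \<inter> {y<..}. f z \<noteq> x"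
    using pre by auto
  ultimately have
    "(\<forall>z\<in>I \<inter> {..<y}. f z < x) \<or> (\<forall>z\<in>I \<inter> {..<y}. x < f z)"
    "(\<forall>z\<in>I \<inter> {y<..}. f z < x) \<or> (\<forall>z\<in>I \<inter> {y<..}. x < f z)"
    using continuous_avoiding_constant_sign by blast+
  moreover have "f y = x" using pre by blast
  ultimately show ?thesis
    unfolding crosses_up_def crosses_down_def
    by (auto simp: Ball_def) (smt (verit))+
qed

locale exact_interval_map =
  fixes I J :: "real set" and f :: "real \<Rightarrow> real"
  assumes interval: "is_interval I"
    and maps_to: "f ` I \<subseteq> I"
    and cont: "continuous_on I f"
    and J_sub: "J \<subseteq> I"
    and image_J: "f ` J = J"
    and preimage_J: "{x \<in> I. f x \<in> J} = J"
    and two_points: "\<exists>x\<in>J. \<exists>y\<in>J. x \<noteq> y"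
    and exact: "topologically_exact_on J f"
begin

lemma funpow_image_J: "(f ^^ k) ` J = J"
proof (induction k)
  case (Suc k)
  have "(f ^^ Suc k) ` J = f ` (f ^^ k) ` J" by (simp add: image_comp)
  then show ?case by (simp add: Suc image_J)
qed simp

text \<open>
  Exactness says that some iterate of \<open>f\<close> spreads \<open>U\<close> over \<open>J\<close>. All later iterates do so too, as
  \<open>f\<close> maps \<open>J\<close> onto itself, hence so does some iterate of \<open>f ^^ k\<close>; but these preserve \<open>U\<close>.
\<close>

lemma invariant_open_is_everything:
  assumes "openin (top_of_set J) U" "U \<noteq> {}" "k \<ge> 1" and inv: "(f ^^ k) ` U \<subseteq> U"
  shows "J \<subseteq> U"
proof -
  obtain n where n: "J \<subseteq> (f ^^ n) ` U"
    using exact assms(1,2) unfolding topologically_exact_on_def by blast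
  \<comment> \<open>From \<open>n\<close> iterations, \<open>k * n - n\<close> further ones reach a multiple of \<open>k\<close>.\<close>
  have "J = (f ^^ (k * n - n)) ` J" by (simp add: funpow_image_J)
  also have "\<dots> \<subseteq> (f ^^ (k * n - n)) ` (f ^^ n) ` U" using n by (rule image_mono)
  also have "\<dots> = (f ^^ (k * n)) ` U"
    using \<open>k \<ge> 1\<close> by (simp add: image_comp funpow_add[symmetric])
  also have "\<dots> = ((f ^^ k) ^^ n) ` U" by (simp add: funpow_mult mult.commute)
  also have "\<dots> \<subseteq> U"
  proof (induction n)
    case (Suc n)
    have "((f ^^ k) ^^ Suc n) ` U = (f ^^ k) ` (((f ^^ k) ^^ n) ` U)" by (simp add: image_comp)
    also have "\<dots> \<subseteq> U" using Suc inv by blast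
    finally show ?case .
  qed simp
  finally show ?thesis .
qed

text \<open>
  If \<open>x \<ge> y\<close>, the points above \<open>y\<close> are mapped above \<open>x\<close>, so they stay above \<open>y\<close>; if \<open>x \<le> y\<close>, the
  same holds below. When \<open>x \<noteq> y\<close> the invariant side contains \<open>x \<in> J\<close>; when \<open>x = y\<close> both sides are
  invariant and one of them contains a second point of \<open>J\<close>.
\<close>

lemma no_upward_crossing:
  assumes "k \<ge> 1" "y \<in> J"
  shows "\<not> crosses_up I (f ^^ k) y x"
proof
  assume cross: "crosses_up I (f ^^ k) y x"
  have xJ: "x \<in> J"
    using cross assms(2) funpow_image_J[of k] unfolding crosses_up_def by blast
  have into_J: "(f ^^ k) z \<in> J" if "z \<in> J" for z
    using that funpow_image_J[of k] by blast
  have sideways: False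
    if "open T" "J \<inter> T \<noteq> {}" "y \<notin> T" "\<And>z. z \<in> J \<inter> T \<Longrightarrow> (f ^^ k) z \<in> T" for T
  proof -
    have "J \<subseteq> J \<inter> T"
      using that assms(1) into_J
      by (intro invariant_open_is_everything[of _ k]) (auto simp: openin_open_Int)
    then show False using \<open>y \<in> J\<close> \<open>y \<notin> T\<close> by blast
  qed
  have up: "(f ^^ k) z \<in> {y<..}" if "y \<le> x" "z \<in> J \<inter> {y<..}" for z
    using cross that J_sub unfolding crosses_up_def by force
  have down: "(f ^^ k) z \<in> {..<y}" if "x \<le> y" "z \<in> J \<inter> {..<y}" for z
    using cross that J_sub unfolding crosses_up_def by force
  obtain w where w: "w \<in> J" "w \<noteq> y" using two_points by metis
  consider "y \<le> x" "J \<inter> {y<..} \<noteq> {}" | "x \<le> y" "J \<inter> {..<y} \<noteq> {}"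
    using xJ w by (cases x y rule: linorder_cases; cases w y rule: linorder_cases) auto
  then show False
  proof cases
    case 1
    then show ?thesis using sideways[of "{y<..}"] up by simp
  next
    case 2
    then show ?thesis using sideways[of "{..<y}"] down by simp
  qed
qed

lemma no_consecutive_downward_crossings:
  assumes "z \<in> J" "crosses_down I f z y" "crosses_down I f y x"
  shows False
  using no_upward_crossing[of 2 z x] crosses_down_twice[OF maps_to assms(2,3)] assms(1) by simp

text \<open>
  Let \<open>M\<close> be the set of points of \<open>S\<close> with several preimages, \<open>E\<close> the set of those that are
  extreme values of \<open>f\<close>, and \<open>A\<close> the set of preimages of \<open>S\<close> outside \<open>S\<close>. Counting preimages
  gives \<open>#M \<le> #A\<close>. The graph of \<open>f\<close> crosses each remaining level once, downwards, and two such
  crossings cannot follow each other, so the remaining points inject into \<open>A \<union> (M \<union> E)\<close> via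
  their preimages.
\<close>

lemma card_forward_invariant_le:
  assumes fin: "finite S" and S: "S \<subseteq> J" and inv: "f ` S \<subseteq> S"
    and finA: "finite ({x \<in> J. f x \<in> S} - S)"
    and cardA: "card ({x \<in> J. f x \<in> S} - S) \<le> n"
  shows "card S \<le> 3 * n + 4"
proof -
  define P where "P = {x \<in> J. f x \<in> S}"
  define A where "A = P - S"
  define fib where "fib x = {z \<in> J. f z = x}" for x
  define M where "M = {x \<in> S. card (fib x) \<ge> 2}"
  define E where "E = {x \<in> S. (\<forall>z\<in>I. f z \<le> x) \<or> (\<forall>z\<in>I. x \<le> f z)}"
  define G where "G = S - (M \<union> E)"

  have SP: "S \<subseteq> P" using S inv by (auto simp: P_def)
  have A: "finite A" "card A \<le> n" using finA cardA by (auto simp: A_def P_def)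
  have PA: "P = S \<union> A" using SP by (auto simp: A_def)
  then have finP: "finite P" using A fin by simp
  have cardP: "card P = card S + card A"
    unfolding PA using A fin by (intro card_Un_disjoint) (auto simp: A_def)
  have fib_fin: "finite (fib x)" if "x \<in> S" for x
    using that finP by (auto simp: fib_def P_def intro: finite_subset[OF _ finP])
  have fib_pos: "card (fib x) \<ge> 1" if "x \<in> S" for x
  proof -
    have "x \<in> f ` J" using that S image_J by blast
    then have "fib x \<noteq> {}" by (auto simp: fib_def)
    then show ?thesis using fib_fin[OF that] by (simp add: Suc_leI card_gt_0_iff)
  qed

  have cardM: "card M \<le> n"
  proof -
    have "card S + card M = (\<Sum>x\<in>S. 1 + (if x \<in> M then 1 else 0))"
    proof -
      have "S \<inter> M = M" by (auto simp: M_def)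
      then show ?thesis unfolding sum.distrib using fin by (simp add: sum.If_cases)
    qed
    also have "\<dots> \<le> (\<Sum>x\<in>S. card (fib x))"
      using fib_pos by (intro sum_mono) (auto simp: M_def)
    also have "\<dots> = card (\<Union>x\<in>S. fib x)"
      using fin fib_fin by (intro card_UN_disjoint[symmetric]) (auto simp: fib_def)
    also have "(\<Union>x\<in>S. fib x) = P" by (auto simp: fib_def P_def)
    finally show ?thesis using cardP A by simp
  qed

  have cardE: "card E \<le> 2"
  proof -
    define E1 where "E1 = {x \<in> S. \<forall>z\<in>I. f z \<le> x}"
    define E2 where "E2 = {x \<in> S. \<forall>z\<in>I. x \<le> f z}"
    have attained: "\<exists>z\<in>I. f z = x" if "x \<in> S" for x
    proof -
      have "x \<in> f ` J" using that S image_J by blast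
      then show ?thesis using J_sub by blast
    qed
    have "finite E1" "finite E2" using fin by (auto simp: E1_def E2_def)
    moreover have "x = y" if "x \<in> E1" "y \<in> E1" for x y
      using that attained[of x] attained[of y] by (fastforce simp: E1_def)
    moreover have "x = y" if "x \<in> E2" "y \<in> E2" for x y
      using that attained[of x] attained[of y] by (fastforce simp: E2_def)
    ultimately have "card E1 \<le> 1" "card E2 \<le> 1"
      by (simp_all add: card_le_Suc0_iff_eq)
    moreover have "E = E1 \<union> E2" by (auto simp: E_def E1_def E2_def)
    ultimately show ?thesis using card_Un_le[of E1 E2] by simp
  qed

  have down: "\<exists>y\<in>P. crosses_down I f y x" if "x \<in> G" for x
  proof -
    have x: "x \<in> S" "x \<notin> M" "x \<notin> E" using that by (auto simp: G_def)
    then have "card (fib x) = 1" using fib_pos[OF x(1)] by (simp add: M_def)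
    then obtain y where y: "fib x = {y}" by (auto simp: card_1_singleton_iff)
    then have yJ: "y \<in> J" "f y = x" by (auto simp: fib_def)
    \<comment> \<open>As \<open>x \<in> J\<close>, all its preimages in \<open>I\<close> lie in \<open>J\<close>.\<close>
    have "{z \<in> I. f z = x} = {y}"
      using y x(1) S J_sub preimage_J by (auto simp: fib_def)
    then have "crosses_up I f y x \<or> crosses_down I f y x"
      using unique_preimage_extreme_or_crossing[OF interval cont] x by (auto simp: E_def)
    then show ?thesis
      using no_upward_crossing[of 1 y x] yJ x(1) by (auto simp: P_def)
  qed
  then obtain h where h: "\<And>x. x \<in> G \<Longrightarrow> h x \<in> P \<and> crosses_down I f (h x) x" by metis

  have GS: "S = G \<union> (M \<union> E)" by (auto simp: G_def M_def E_def)
  have ME: "finite (M \<union> E)" "card (M \<union> E) \<le> n + 2"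
    using fin cardM cardE card_Un_le[of M E] by (auto simp: M_def E_def)
  have "inj_on h G"
    using h unfolding crosses_down_def by (metis inj_onI)
  moreover have "h ` G \<subseteq> A \<union> (M \<union> E)"
  proof
    fix y assume "y \<in> h ` G"
    then obtain x where x: "x \<in> G" "y = h x" by blast
    have "y \<notin> G"
    proof
      assume "y \<in> G"
      then show False
        using h[of y] h[OF x(1)] x(2) no_consecutive_downward_crossings[of "h y" y x]
        by (auto simp: P_def)
    qed
    then show "y \<in> A \<union> (M \<union> E)" using h[OF x(1)] x(2) PA GS by auto
  qed
  ultimately have "card G \<le> card (A \<union> (M \<union> E))"
    using A ME by (metis card_image card_mono finite_UnI)
  also have "\<dots> \<le> n + (n + 2)"
    using card_Un_le[of A "M \<union> E"] A ME by linarith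
  finally have "card G \<le> n + (n + 2)" .
  moreover have "card S \<le> card G + card (M \<union> E)"
    using card_Un_le[of G "M \<union> E"] GS by simp
  ultimately show ?thesis using ME by linarith
qed

text \<open>
  A family \<open>F\<close> may be infinite: too many points in its union would already lie in the union of
  finitely many of its members, which again satisfies the hypotheses of
  \<open>card_forward_invariant_le\<close>.
\<close>

lemma card_Union_forward_invariant_le:
  assumes F: "\<And>S. S \<in> F \<Longrightarrow> finite S \<and> S \<subseteq> J \<and> f ` S \<subseteq> S \<and> {x \<in> J. f x \<in> S} - S \<subseteq> C"
    and C: "finite C" "card C \<le> n"
  shows "finite (\<Union>F) \<and> card (\<Union>F) \<le> 3 * n + 4"
proof (rule finite_if_finite_subsets_card_bdd)
  fix T assume T: "T \<subseteq> \<Union>F" "finite T"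
  obtain F' where F': "F' \<subseteq> F" "finite F'" "T \<subseteq> \<Union>F'"
    using finite_subset_Union[OF T(2,1)] by metis
  let ?S = "\<Union>F'"
  have S: "finite ?S" "?S \<subseteq> J" "f ` ?S \<subseteq> ?S"
    using F F' by blast+
  have "{x \<in> J. f x \<in> ?S} - ?S \<subseteq> C"
    using F F'(1) by blast
  then have "finite ({x \<in> J. f x \<in> ?S} - ?S)" "card ({x \<in> J. f x \<in> ?S} - ?S) \<le> n"
    using C card_mono[of C] by (auto intro: finite_subset order_trans)
  then have "card ?S \<le> 3 * n + 4"
    using S by (intro card_forward_invariant_le)
  then show "card T \<le> 3 * n + 4"
    using card_mono[OF S(1) F'(3)] by linarith
qed

end

lemma class_A_exact_interval_map:
  assumes "is_interval I" "f \<in> class_A I"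
  shows "exact_interval_map I (Julia I f) f"
  using assms differentiable_imp_continuous_on[of f I]
  unfolding exact_interval_map_def class_A_def by (auto simp: Julia_def)

theorem corollary2p4:
  fixes I :: "real set" and n :: nat
  assumes "compact I" and "is_interval I"
  shows "(SUP f\<in>class_A_n I n. ecard (Sigma_max I f)) \<le> enat (3 * n + 4)"
proof (rule SUP_least)
  fix f assume f: "f \<in> class_A_n I n"
  then have fA: "f \<in> class_A I" by (simp add: class_A_n_def)
  interpret exact_interval_map I "Julia I f" f
    using class_A_exact_interval_map[OF assms(2) fA] .
  have "finite (Crit_Julia I f)" "card (Crit_Julia I f) \<le> n"
    using f fA by (auto simp: class_A_n_def class_A_def Crit_Julia_def)
  then have "finite (Sigma_max I f) \<and> card (Sigma_max I f) \<le> 3 * n + 4"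
    unfolding Sigma_max_def
    by (intro card_Union_forward_invariant_le) (auto simp: exceptional_def)
  then show "ecard (Sigma_max I f) \<le> enat (3 * n + 4)"
    by (simp add: ecard_def)
qed

end
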